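(* Let $G$ be a finite group and let $H \subseteq K$ be subgroups of $G$. If $g \in K$ then $$\Pr\nolimits_g(H,\operatorname{Aut}(K)) = \frac{1}{|H||\operatorname{Aut}(K)|}\sum_{\substack{x\in H\\ xg\in \operatorname{orb}_K(x)}}|C_{\operatorname{Aut}(K)}(x)| = \frac{1}{|H|}\sum_{\substack{x\in H\\ xg\in \operatorname{orb}_K(x)}}\frac{1}{|\operatorname{orb}_K(x)|}.$$
   Context: For $x\in K$ and $\alpha\in\operatorname{Aut}(K)$ (the automorphism group of $K$), the autocommutator is $[x,\alpha]=x^{-1}\alpha(x)$. For $g\in K$, $\Pr_g(H,\operatorname{Aut}(K)) = \frac{|\{(x,\alpha)\in H\times \operatorname{Aut}(K) : [x,\alpha]=g\}|}{|H||\operatorname{Aut}(K)|}$. For $x\in K$, $\operatorname{orb}_K(x)=\{\alpha(x):\alpha\in\operatorname{Aut}(K)\}$ and $C_{\operatorname{Aut}(K)}(x)=\{\alpha\in\operatorname{Aut}(K):\alpha(x)=x\}$. *)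

theory Defs
  imports Complex_Main "HOL-Algebra.Group_Action"
begin

text \<open>
  Throughout, \<open>G\<close> is the ambient group and \<open>K\<close> the carrier of a subgroup. The library's \<^const>\<open>auto\<close>
  contains only functions that are \<^const>\<open>extensional\<close> on the carrier, so each automorphism of \<open>K\<close>
  is counted exactly once.
\<close>

definition Aut :: "('a, 'b) monoid_scheme \<Rightarrow> 'a set \<Rightarrow> ('a \<Rightarrow> 'a) set"
  where "Aut G K = auto (G\<lparr>carrier := K\<rparr>)"

definition autocommutator :: "('a, 'b) monoid_scheme \<Rightarrow> 'a \<Rightarrow> ('a \<Rightarrow> 'a) \<Rightarrow> 'a"
  where "autocommutator G x \<alpha> = inv\<^bsub>G\<^esub> x \<otimes>\<^bsub>G\<^esub> \<alpha> x"

definition autocomm_prob ::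
    "('a, 'b) monoid_scheme \<Rightarrow> 'a set \<Rightarrow> 'a set \<Rightarrow> 'a \<Rightarrow> real"
  where "autocomm_prob G H K g =
    real (card {(x, \<alpha>) \<in> H \<times> Aut G K. autocommutator G x \<alpha> = g}) /
      (real (card H) * real (card (Aut G K)))"

text \<open>
  The action of \<open>Aut(K)\<close> on \<open>K\<close> is evaluation, so the action map of the library's \<^const>\<open>orbit\<close>
  and \<^const>\<open>stabilizer\<close> is the identity.
\<close>

definition aut_orbit :: "('a, 'b) monoid_scheme \<Rightarrow> 'a set \<Rightarrow> 'a \<Rightarrow> 'a set"
  where "aut_orbit G K x = orbit (AutoGroup (G\<lparr>carrier := K\<rparr>)) (\<lambda>\<alpha>. \<alpha>) x"

definition aut_centralizer :: "('a, 'b) monoid_scheme \<Rightarrow> 'a set \<Rightarrow> 'a \<Rightarrow> ('a \<Rightarrow> 'a) set"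
  where "aut_centralizer G K x = stabilizer (AutoGroup (G\<lparr>carrier := K\<rparr>)) (\<lambda>\<alpha>. \<alpha>) x"

end

theory Submission
  imports Defs
begin

text \<open>
  For fixed \<open>x \<in> H\<close>, the automorphisms \<open>\<alpha>\<close> with \<open>[x, \<alpha>] = g\<close> are those with \<open>\<alpha> x = x g\<close>.
  There are none if \<open>x g\<close> lies outside the orbit of \<open>x\<close>; otherwise composition with one of them
  is a bijection from the centralizer of \<open>x\<close> onto their set. The second equality is the
  orbit-stabilizer theorem.
\<close>

text \<open>\<open>AutoGroup G\<close> is \<open>BijGroup (carrier G)\<close> with its carrier cut
  down to \<open>auto G\<close>, so the action map is just an inclusion. This makes the library's
  orbit and stabilizer results available for automorphisms.\<close>

lemma (in group) AutoGroup_action: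
  "group_action (AutoGroup G) (carrier G) (\<lambda>\<alpha>. \<alpha>)"
proof -
  have "(\<lambda>\<alpha>. \<alpha>) \<in> hom (AutoGroup G) (BijGroup (carrier G))"
    using subgroup.subset[OF subgroup_auto] by (auto simp: hom_def AutoGroup_def)
  then show ?thesis
    unfolding group_action_def group_hom_def group_hom_axioms_def
    using AutoGroup group_BijGroup by blast
qed

text \<open>Membership in \<open>Bij\<close> includes extensionality, which confines automorphisms
  to a finite function space.\<close>

lemma (in group) finite_auto:
  assumes "finite (carrier G)"
  shows "finite (auto G)"
proof (rule finite_subset)
  show "auto G \<subseteq> (carrier G \<rightarrow>\<^sub>E carrier G)"
    by (auto simp: auto_def PiE_def hom_def Bij_def)
  show "finite (carrier G \<rightarrow>\<^sub>E carrier G)"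
    using assms by (simp add: finite_PiE)
qed

text \<open>The set on the left is the left coset of the stabilizer by \<open>h\<close>;
  multiplication by \<open>inv h\<close> undoes the translation.\<close>

lemma (in group_action) card_transporter:
  assumes "x \<in> E" "h \<in> carrier G"
  shows "card {a \<in> carrier G. (\<phi> a) x = (\<phi> h) x} = card (stabilizer G \<phi> x)"
proof -
  interpret G: group G
    using group_hom group_hom.axioms(1) by blast
  have inv_h: "inv h \<in> carrier G"
    using assms(2) by simp
  have "bij_betw (\<lambda>s. h \<otimes> s) (stabilizer G \<phi> x) {a \<in> carrier G. (\<phi> a) x = (\<phi> h) x}"
  proof (rule bij_betw_byWitness[where f' = "\<lambda>a. inv h \<otimes> a"])
    show "\<forall>s\<in>stabilizer G \<phi> x. inv h \<otimes> (h \<otimes> s) = s"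
      using assms(2) by (simp add: stabilizer_def G.inv_solve_left')
    show "\<forall>a\<in>{a \<in> carrier G. (\<phi> a) x = (\<phi> h) x}. h \<otimes> (inv h \<otimes> a) = a"
      using assms(2) by (simp add: G.m_assoc[symmetric])
    show "(\<lambda>s. h \<otimes> s) ` stabilizer G \<phi> x \<subseteq> {a \<in> carrier G. (\<phi> a) x = (\<phi> h) x}"
      using assms by (auto simp: stabilizer_def composition_rule)
    \<comment> \<open>The element \<open>a\<close> sends \<open>x\<close> to
      \<open>(\<phi> h) x\<close>, and \<open>inv h\<close> brings that point back to
      \<open>x\<close>.\<close>
    have "(\<phi> (inv h \<otimes> a)) x = x" if "a \<in> carrier G" "(\<phi> a) x = (\<phi> h) x" for a
      using that assms inv_h composition_rule[of x "inv h" a] orbit_sym_aux[of h x "(\<phi> h) x"]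
      by simp
    then show "(\<lambda>a. inv h \<otimes> a) ` {a \<in> carrier G. (\<phi> a) x = (\<phi> h) x} \<subseteq> stabilizer G \<phi> x"
      using inv_h by (auto simp: stabilizer_def)
  qed
  then show ?thesis
    by (simp add: bij_betw_same_card)
qed

theorem theorem2p3:
  fixes G :: "('a, 'b) monoid_scheme" (structure)
    and H K :: "'a set" and g :: 'a
  assumes "group G" and "finite (carrier G)"
    and "subgroup H G" and "subgroup K G" and "H \<subseteq> K"
    and "g \<in> K"
  shows "autocomm_prob G H K g =
           1 / (real (card H) * real (card (Aut G K))) *
             (\<Sum>x | x \<in> H \<and> x \<otimes> g \<in> aut_orbit G K x. real (card (aut_centralizer G K x)))
       \<and> 1 / (real (card H) * real (card (Aut G K))) *
             (\<Sum>x | x \<in> H \<and> x \<otimes> g \<in> aut_orbit G K x. real (card (aut_centralizer G K x))) =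
           1 / real (card H) *
             (\<Sum>x | x \<in> H \<and> x \<otimes> g \<in> aut_orbit G K x. 1 / real (card (aut_orbit G K x)))"
proof -
  interpret G: group G by fact
  let ?K = "G\<lparr>carrier := K\<rparr>"
  let ?S = "{x \<in> H. x \<otimes> g \<in> aut_orbit G K x}"
  interpret K: group ?K
    using subgroup.subgroup_is_group[OF assms(4,1)] .
  interpret A: group_action "AutoGroup ?K" K "\<lambda>\<alpha>. \<alpha>"
    using K.AutoGroup_action by simp
  have K_sub: "K \<subseteq> carrier G"
    by (rule subgroup.subset) fact
  then have fin_K: "finite K"
    using assms(2) finite_subset by blast
  have fin_H: "finite H"
    using assms(5) fin_K finite_subset by blast
  have carrier_A: "carrier (AutoGroup ?K) = Aut G K"
    by (simp add: AutoGroup_def Aut_def)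
  have fin_A: "finite (Aut G K)"
    unfolding Aut_def using K.finite_auto fin_K by simp
  \<comment> \<open>The identity on \<open>K\<close> is a witness. Nonvanishing of
    \<open>card (Aut G K)\<close> serves twice: to show that orbits have nonzero size and to cancel
    this factor at the end.\<close>
  have "Aut G K \<noteq> {}"
    using K.id_in_auto unfolding Aut_def by blast
  then have A_pos: "card (Aut G K) \<noteq> 0"
    using fin_A by simp
  have orb: "aut_orbit G K x = (\<lambda>\<alpha>. \<alpha> x) ` Aut G K" for x
    by (auto simp: aut_orbit_def orbit_def carrier_A)
  have Aut_in_K: "\<alpha> x \<in> K" if "\<alpha> \<in> Aut G K" "x \<in> K" for \<alpha> x
    using A.element_image[of \<alpha> x "\<alpha> x"] that carrier_A by simp
  have comm_iff: "autocommutator G x \<alpha> = g \<longleftrightarrow> \<alpha> x = x \<otimes> g"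
    if "x \<in> H" "\<alpha> \<in> Aut G K" for x \<alpha>
  proof -
    \<comment> \<open>The inverse in \<open>autocommutator\<close> is taken in \<open>G\<close>, so
      the equation is solved for \<open>\<alpha> x\<close> in \<open>G\<close> rather than in
      \<open>K\<close>.\<close>
    have "x \<in> carrier G" "\<alpha> x \<in> carrier G" "g \<in> carrier G"
      using that assms(5,6) K_sub Aut_in_K by blast+
    then show ?thesis
      unfolding autocommutator_def by (simp add: G.inv_solve_left')
  qed
  have fibre: "card {\<alpha> \<in> Aut G K. autocommutator G x \<alpha> = g} =
      (if x \<otimes> g \<in> aut_orbit G K x then card (aut_centralizer G K x) else 0)"
    if "x \<in> H" for x
  proof (cases "x \<otimes> g \<in> aut_orbit G K x")
    case True
    then obtain \<beta> where \<beta>: "\<beta> \<in> Aut G K" "\<beta> x = x \<otimes> g"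
      unfolding orb by force
    then have "{\<alpha> \<in> Aut G K. autocommutator G x \<alpha> = g} = {\<alpha> \<in> Aut G K. \<alpha> x = \<beta> x}"
      using comm_iff[OF that] by auto
    then show ?thesis
      \<comment> \<open>Here \<open>\<beta>\<close> serves as the coset representative.\<close>
      using A.card_transporter[of x \<beta>] True \<beta>(1) that assms(5)
      by (auto simp: carrier_A aut_centralizer_def)
  next
    case False
    have "autocommutator G x \<alpha> \<noteq> g" if \<alpha>: "\<alpha> \<in> Aut G K" for \<alpha>
    proof
      assume "autocommutator G x \<alpha> = g"
      then have "x \<otimes> g = \<alpha> x"
        using comm_iff[OF \<open>x \<in> H\<close> \<alpha>] by simp
      then have "x \<otimes> g \<in> aut_orbit G K x"
        unfolding orb using \<alpha> by (rule image_eqI)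
      with False show "False" ..
    qed
    then have "{\<alpha> \<in> Aut G K. autocommutator G x \<alpha> = g} = {}"
      by blast
    then show ?thesis
      using False by (simp only: card.empty if_False)
  qed
  \<comment> \<open>Slicing the set of pairs by the first coordinate turns its cardinality into a
    sum of fibre sizes.\<close>
  have "{(x, \<alpha>) \<in> H \<times> Aut G K. autocommutator G x \<alpha> = g} =
      (SIGMA x:H. {\<alpha> \<in> Aut G K. autocommutator G x \<alpha> = g})"
    by auto
  then have "card {(x, \<alpha>) \<in> H \<times> Aut G K. autocommutator G x \<alpha> = g} =
      (\<Sum>x\<in>H. card {\<alpha> \<in> Aut G K. autocommutator G x \<alpha> = g})"
    using fin_H fin_A by simp
  also have "\<dots> = (\<Sum>x\<in>H. if x \<otimes> g \<in> aut_orbit G K x then card (aut_centralizer G K x) else 0)"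
    by (intro sum.cong refl fibre)
  also have "\<dots> = (\<Sum>x\<in>?S. card (aut_centralizer G K x))"
    using fin_H by (simp add: sum.inter_filter)
  finally have first: "autocomm_prob G H K g =
      1 / (real (card H) * real (card (Aut G K))) *
        (\<Sum>x\<in>?S. real (card (aut_centralizer G K x)))"
    by (simp add: autocomm_prob_def)
  have "real (card (aut_centralizer G K x)) = real (card (Aut G K)) * (1 / real (card (aut_orbit G K x)))"
    if "x \<in> H" for x
  proof -
    have "x \<in> K"
      using that assms(5) by blast
    from A.orbit_stabilizer_theorem[OF this]
    have eq: "card (aut_orbit G K x) * card (aut_centralizer G K x) = card (Aut G K)"
      by (simp add: aut_orbit_def aut_centralizer_def order_def carrier_A)
    \<comment> \<open>An orbit of size zero would force \<open>card (Aut G K)\<close> to be zero.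
      The quotient below is therefore a genuine one, not the default value of division by
      zero.\<close>
    then have "card (aut_orbit G K x) \<noteq> 0"
      using A_pos by (metis mult_zero_left)
    then show ?thesis
      by (simp add: eq[symmetric])
  qed
  then have "(\<Sum>x\<in>?S. real (card (aut_centralizer G K x))) =
      real (card (Aut G K)) * (\<Sum>x\<in>?S. 1 / real (card (aut_orbit G K x)))"
    unfolding sum_distrib_left by (intro sum.cong) auto
  then show ?thesis
    using first A_pos by simp
qed

end
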